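(* Let $P$ be a data distribution on $\mathcal Z$ and suppose that for every $z\in\mathcal Z$ the loss $l(\cdot;z)$ is a quadratic function that is $\alpha$-strongly convex, $\beta$-smooth and $L$-Lipschitz on $\Omega$, where $0<\alpha\le\beta$; put $\kappa=\beta/\alpha$. Consider Nesterov's accelerated gradient descent with fixed momentum parameter $\frac{\sqrt\kappa-1}{\sqrt\kappa+1}$ and step-size $0<\eta\le\frac1\beta$ on the empirical risk $R_S$ with sample size $n$, whose output at iteration $T\ge1$ is $\hat\theta_T$. Then its uniform stability satisfies $$\mathcal E_{\mathrm{stab}}^{\mathrm{NAG,\,strongly\ convex}}(\hat\theta_T,l,P,n)\le\frac{4L^2}{\alpha n}\left(1-\left(1-\frac1{\sqrt\kappa}\right)^T\right).$$
   Context: $\Omega\subset\mathbb R^d$ is a convex parameter set, $l(\theta;z)$ a loss for $\theta\in\Omega$, $z\in\mathcal Z$; for a sample $S=(z_1,\dots,z_n)$ drawn i.i.d. from $P$, $R_S(\theta)=\frac1n\sum_{j=1}^n l(\theta;z_j)$. The method on an objective $F$ starts at $\theta_0=w_0\in\Omega$ (the same for all samples) and iterates, for $t\ge0$, $$\theta_{t+1}=w_t-\eta\nabla F(w_t),\qquad w_{t+1}=\left(1+\frac{\sqrt\kappa-1}{\sqrt\kappa+1}\right)\theta_{t+1}-\frac{\sqrt\kappa-1}{\sqrt\kappa+1}\,\theta_t .$$ Here $F=R_S$ and $\hat\theta_T=\theta_T$. The iterates $\theta_t,w_t$ are assumed to remain in $\Omega$. Uniform stability: an algorithm with output $\hat\theta_S$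 on sample $S$ is $\epsilon$-uniformly stable if for all $k\in\{1,\dots,n\}$ and all pairs of samples $S=(z_1,\dots,z_k,\dots,z_n)$, $S'=(z_1,\dots,z_k',\dots,z_n)$ with entries drawn i.i.d. from $P$, $\sup_{z\in\mathcal Z}|l(\hat\theta_S;z)-l(\hat\theta_{S'};z)|\le\epsilon$; $\mathcal E_{\mathrm{stab}}(\hat\theta,l,P,n)$ is the smallest such $\epsilon$. $f$ is $L$-Lipschitz if $|f(u)-f(v)|\le L\|u-v\|_2$ for all $u,v\in\Omega$. For a quadratic $f$, $\alpha$-strong convexity and $\beta$-smoothness mean its (constant) Hessian $H$ satisfies $\alpha I\preceq H\preceq\beta I$. *)

theory Defs
  imports "HOL-Analysis.Analysis" "HOL-Probability.Probability"
begin

definition gradient :: "('a::real_inner \<Rightarrow> real) \<Rightarrow> 'a \<Rightarrow> 'a" where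
  "gradient f x = (THE D. GDERIV f x :> D)"

lemma gradient_eqI:
  assumes "GDERIV f x :> D"
  shows "gradient f x = D"
  unfolding gradient_def
proof (rule the_equality)
  show "GDERIV f x :> D" by (rule assms)
  fix D' assume "GDERIV f x :> D'"
  then have "(\<lambda>h. h \<bullet> D') = (\<lambda>h. h \<bullet> D)"
    using assms unfolding gderiv_def by (rule has_derivative_unique)
  then have "h \<bullet> D' = h \<bullet> D" for h
    by (rule fun_cong)
  then show "D' = D"
    by (metis vector_eq_ldot)
qed

definition quadratic :: "(real ^ 'd \<Rightarrow> real) \<Rightarrow> bool" where
  "quadratic f \<longleftrightarrow> (\<exists>A b c. \<forall>x. f x = x \<bullet> (A *v x) + b \<bullet> x + c)"

definition has_constant_hessian :: "(real ^ 'd \<Rightarrow> real) \<Rightarrow> real ^ 'd ^ 'd \<Rightarrow> bool" where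
  "has_constant_hessian f H \<longleftrightarrow> (\<forall>x. (gradient f has_derivative (\<lambda>v. H *v v)) (at x))"

text \<open>The Loewner order; it is only used for symmetric matrices (Hessians of quadratics).\<close>

definition loewner_le :: "real ^ 'd ^ 'd \<Rightarrow> real ^ 'd ^ 'd \<Rightarrow> bool" where
  "loewner_le A B \<longleftrightarrow> (\<forall>v. v \<bullet> (A *v v) \<le> v \<bullet> (B *v v))"

text \<open>For quadratic functions, whose Hessian exists and is unique. Note that
  \<open>mat a\<close> is \<open>a\<close> times the identity matrix.\<close>

definition quadratic_strongly_convex :: "real \<Rightarrow> (real ^ 'd \<Rightarrow> real) \<Rightarrow> bool" where
  "quadratic_strongly_convex \<alpha> f \<longleftrightarrow>
     quadratic f \<and> (\<exists>H. has_constant_hessian f H \<and> loewner_le (mat \<alpha>) H)"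

definition quadratic_smooth :: "real \<Rightarrow> (real ^ 'd \<Rightarrow> real) \<Rightarrow> bool" where
  "quadratic_smooth \<beta> f \<longleftrightarrow>
     quadratic f \<and> (\<exists>H. has_constant_hessian f H \<and> loewner_le H (mat \<beta>))"

text \<open>Every quadratic function does have a constant Hessian, \<open>A + transpose A\<close>.\<close>

lemma gderiv_quadratic:
  fixes A :: "real ^ 'd ^ 'd"
  shows "GDERIV (\<lambda>x. x \<bullet> (A *v x) + b \<bullet> x + c) x :> (A + transpose A) *v x + b"
  unfolding gderiv_def
proof (rule has_derivative_eq_rhs)
  show "((\<lambda>x. x \<bullet> (A *v x) + b \<bullet> x + c) has_derivative
      (\<lambda>h. x \<bullet> (A *v h) + h \<bullet> (A *v x) + b \<bullet> h)) (at x)"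
    by (auto intro!: derivative_eq_intros
        bounded_linear_imp_has_derivative matrix_vector_mul_bounded_linear)
  show "(\<lambda>h. x \<bullet> (A *v h) + h \<bullet> (A *v x) + b \<bullet> h) = (\<lambda>h. h \<bullet> ((A + transpose A) *v x + b))"
    by (simp add: fun_eq_iff inner_add_right matrix_vector_mult_add_rdistrib
        dot_lmul_matrix[symmetric] inner_commute[of b])
      (simp add: inner_commute)
qed

lemma has_constant_hessian_quadratic:
  fixes A :: "real ^ 'd ^ 'd"
  shows "has_constant_hessian (\<lambda>x. x \<bullet> (A *v x) + b \<bullet> x + c) (A + transpose A)"
  unfolding has_constant_hessian_def gradient_eqI[OF gderiv_quadratic, abs_def]
  by (intro allI has_derivative_add_const bounded_linear_imp_has_derivative
      matrix_vector_mul_bounded_linear)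

text \<open>A sample of size \<open>n\<close> is a point of the \<open>n\<close>-fold power of the sample space, with entries
  indexed by \<open>1, \<dots>, n\<close>.\<close>

definition samples :: "nat \<Rightarrow> 'z measure \<Rightarrow> (nat \<Rightarrow> 'z) set" where
  "samples n P = space (Pi\<^sub>M {1..n} (\<lambda>_. P))"

definition empirical_risk ::
    "('a \<Rightarrow> 'z \<Rightarrow> real) \<Rightarrow> nat \<Rightarrow> (nat \<Rightarrow> 'z) \<Rightarrow> 'a \<Rightarrow> real" where
  "empirical_risk l n S \<theta> = (1 / real n) * (\<Sum>j = 1..n. l \<theta> (S j))"

text \<open>The state after \<open>t\<close> iterations is the pair \<open>(\<theta>\<^sub>t, w\<^sub>t)\<close>; \<open>\<gamma>\<close> is the momentum parameter.\<close>

primrec nag :: "real \<Rightarrow> real \<Rightarrow> ('a::real_inner \<Rightarrow> real) \<Rightarrow> 'a \<Rightarrow> nat \<Rightarrow> 'a \<times> 'a" where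
  "nag \<eta> \<gamma> F w0 0 = (w0, w0)"
| "nag \<eta> \<gamma> F w0 (Suc t) =
     (let \<theta> = fst (nag \<eta> \<gamma> F w0 t);
          w = snd (nag \<eta> \<gamma> F w0 t);
          \<theta>' = w - \<eta> *\<^sub>R gradient F w
      in (\<theta>', (1 + \<gamma>) *\<^sub>R \<theta>' - \<gamma> *\<^sub>R \<theta>))"

definition nag_momentum :: "real \<Rightarrow> real" where
  "nag_momentum \<kappa> = (sqrt \<kappa> - 1) / (sqrt \<kappa> + 1)"

text \<open>The supremum is taken in the extended reals, so that it is \<open>\<infinity>\<close> if unbounded.\<close>

definition uniformly_stable ::
    "((nat \<Rightarrow> 'z) \<Rightarrow> 'a) \<Rightarrow> ('a \<Rightarrow> 'z \<Rightarrow> real) \<Rightarrow> 'z measure \<Rightarrow> nat \<Rightarrow> real \<Rightarrow> bool" where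
  "uniformly_stable alg l P n \<epsilon> \<longleftrightarrow>
     (\<forall>k\<in>{1..n}. \<forall>S\<in>samples n P. \<forall>S'\<in>samples n P.
        (\<forall>j\<in>{1..n} - {k}. S j = S' j) \<longrightarrow>
        (SUP z\<in>space P. ereal \<bar>l (alg S) z - l (alg S') z\<bar>) \<le> ereal \<epsilon>)"

text \<open>\<open>\<infinity>\<close> if the algorithm is not uniformly stable for any \<open>\<epsilon>\<close>.\<close>

definition stability ::
    "((nat \<Rightarrow> 'z) \<Rightarrow> 'a) \<Rightarrow> ('a \<Rightarrow> 'z \<Rightarrow> real) \<Rightarrow> 'z measure \<Rightarrow> nat \<Rightarrow> ereal" where
  "stability alg l P n = Inf {ereal \<epsilon> | \<epsilon>. uniformly_stable alg l P n \<epsilon>}"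

end

theory Submission
  imports Defs
begin

text \<open>The difference of the two runs obeys the linear recursion of the method with the common
  Hessian \<open>H\<close>, driven by the difference of the gradients of the two exchanged losses, which has
  norm at most \<open>2 L / n\<close> along the affine hull of \<open>\<Omega>\<close>. In a basis diagonalising \<open>H\<close> each
  coordinate is the convolution of this input with the impulse response \<open>p\<^sub>t(\<mu>)\<close>, where
  \<open>\<mu> = 1 - \<eta> h\<close> for an eigenvalue \<open>h\<close>. Since \<open>\<eta> \<le> 1 / \<beta>\<close>, the slowest mode
  \<open>\<nu> = 1 - \<eta> \<alpha>\<close> is critically damped or overdamped, so that \<open>p\<^sub>t(\<nu>)\<close> is nonnegative and dominates
  all \<open>\<bar>p\<^sub>t(\<mu>)\<bar>\<close>. Its partial sums are \<open>(1 - \<delta>\<^sub>T) / (\<eta> \<alpha>)\<close>, where the defect \<open>\<delta>\<^sub>T\<close> decays no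
  faster than \<open>(1 - 1 / \<surd>\<kappa>)\<^sup>T\<close>. This gives the bound even with \<open>2\<close> in place of \<open>4\<close>.\<close>

section \<open>Impulse response of the scalar momentum recursion\<close>

text \<open>If \<open>r1\<close>, \<open>r2\<close> are the roots of
  \<open>z^2 - \<mu> (1 + \<gamma>) z + \<gamma> \<mu>\<close>, this is the sum of
  \<open>r1^i r2^(t - i)\<close> over \<open>i \<le> t\<close>. The first two values continue the
  recursion from the value 0 at time -1.\<close>

fun nag_impulse :: "real \<Rightarrow> real \<Rightarrow> nat \<Rightarrow> real" where
  "nag_impulse \<gamma> \<mu> 0 = 1"
| "nag_impulse \<gamma> \<mu> (Suc 0) = \<mu> * (1 + \<gamma>)"
| "nag_impulse \<gamma> \<mu> (Suc (Suc t)) =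
     \<mu> * ((1 + \<gamma>) * nag_impulse \<gamma> \<mu> (Suc t) - \<gamma> * nag_impulse \<gamma> \<mu> t)"

text \<open>Variation of constants: by linearity each input \<open>u j\<close> starts an impulse at
  time \<open>j + 1\<close>, and the responses add up.\<close>

lemma nag_impulse_convolution:
  fixes x u :: "nat \<Rightarrow> real"
  assumes "x 0 = 0" and "x 1 = u 0"
    and rec: "\<And>t. x (Suc (Suc t)) = \<mu> * ((1 + \<gamma>) * x (Suc t) - \<gamma> * x t) + u (Suc t)"
  shows "x t = (\<Sum>j<t. nag_impulse \<gamma> \<mu> (t - 1 - j) * u j)"
proof (induction t rule: less_induct)
  case (less t)
  consider "t = 0" | "t = 1" | m where "t = Suc (Suc m)"
    by (metis One_nat_def not0_implies_Suc)
  then show ?case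
  proof cases
    case 3
    \<comment> \<open>The last two inputs carry the initial values of the response; for
      \<open>j < m\<close> the lag is at least 2, so its recursion applies.\<close>
    have "(\<Sum>j<t. nag_impulse \<gamma> \<mu> (t - 1 - j) * u j)
        = u (Suc m) + \<mu> * (1 + \<gamma>) * u m + (\<Sum>j<m. nag_impulse \<gamma> \<mu> (Suc (Suc (m - 1 - j))) * u j)"
    proof -
      have "(\<Sum>j<m. nag_impulse \<gamma> \<mu> (t - 1 - j) * u j)
          = (\<Sum>j<m. nag_impulse \<gamma> \<mu> (Suc (Suc (m - 1 - j))) * u j)"
        unfolding 3 by (intro sum.cong refl arg_cong2[where f = "(*)"]
            arg_cong[where f = "nag_impulse \<gamma> \<mu>"]) auto
      moreover have "{..<t} = {..<Suc (Suc m)}" using 3 by simp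
      ultimately show ?thesis by (simp add: 3 del: nag_impulse.simps(3))
    qed
    also have "(\<Sum>j<m. nag_impulse \<gamma> \<mu> (Suc (Suc (m - 1 - j))) * u j)
        = \<mu> * (1 + \<gamma>) * (\<Sum>j<m. nag_impulse \<gamma> \<mu> (Suc m - 1 - j) * u j) - \<mu> * \<gamma> * x m"
    proof -
      have "nag_impulse \<gamma> \<mu> (Suc (Suc (m - 1 - j))) * u j
        = \<mu> * (1 + \<gamma>) * (nag_impulse \<gamma> \<mu> (Suc m - 1 - j) * u j)
          - \<mu> * \<gamma> * (nag_impulse \<gamma> \<mu> (m - 1 - j) * u j)" if "j < m" for j
      proof -
        have "Suc m - 1 - j = Suc (m - 1 - j)" using that by simp
        then show ?thesis by (simp add: algebra_simps)
      qed
      moreover have "x m = (\<Sum>j<m. nag_impulse \<gamma> \<mu> (m - 1 - j) * u j)"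
        using less[of m] 3 by simp
      ultimately show ?thesis
        by (simp add: sum_distrib_left sum_subtractf)
    qed
    \<comment> \<open>The convolution for \<open>x (Suc m)\<close> has one more term,
      \<open>j = m\<close>, with coefficient 1.\<close>
    also have "(\<Sum>j<m. nag_impulse \<gamma> \<mu> (Suc m - 1 - j) * u j) = x (Suc m) - u m"
      using less[of "Suc m"] 3 by simp
    finally show ?thesis
      unfolding 3 rec by (simp add: algebra_simps)
  qed (use assms in auto)
qed

section \<open>Overdamped, critical and underdamped modes\<close>

context
  fixes s \<gamma> \<rho> :: real
  assumes s: "1 \<le> s" and \<gamma>: "\<gamma> = (s - 1) / (s + 1)" and \<rho>: "\<rho> = 1 - 1 / s"
begin

lemma nag_params: "0 \<le> \<gamma>" "\<gamma> \<le> \<rho>" "0 \<le> \<rho>" "\<rho> \<le> 1 - 1 / s\<^sup>2"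
  using s unfolding \<gamma> \<rho> by (simp_all add: power2_eq_square field_simps)

text \<open>The momentum is tuned to critical damping: at \<open>\<mu> = 1 - 1 / s^2\<close> the
  characteristic polynomial is \<open>(z - \<rho>)^2\<close>.\<close>

lemma nag_critical:
  shows "(1 - 1 / s\<^sup>2) * (1 + \<gamma>) = 2 * \<rho>" "(1 - 1 / s\<^sup>2) * \<gamma> = \<rho>\<^sup>2"
  using s unfolding \<gamma> \<rho>
  by (simp_all add: divide_simps power2_eq_square) (simp_all add: algebra_simps)

lemma nag_extrapolation_nonneg:
  assumes "0 \<le> x" and "\<rho> * x \<le> y"
  shows "0 \<le> (1 + \<gamma>) * y - \<gamma> * x"
proof -
  have "\<gamma> * x \<le> \<rho> * x" using nag_params assms by (intro mult_right_mono)
  moreover have "0 \<le> \<rho> * x" using nag_params assms by (intro mult_nonneg_nonneg)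
  ultimately have "\<gamma> * x \<le> y" "0 \<le> y" using assms by linarith+
  moreover from this have "0 \<le> \<gamma> * y" using nag_params by (intro mult_nonneg_nonneg)
  ultimately show ?thesis by (simp add: distrib_right)
qed

text \<open>The extrapolated value is nonnegative, so replacing \<open>\<mu>\<close> by the critical
  value can only lower the next term. There
  \<open>2 \<rho> y - \<rho>^2 x = \<rho> y + \<rho> (y - \<rho> x)\<close>, so the growth condition
  reproduces itself. An inequality suffices as recursion, which lets differences of two responses
  qualify.\<close>

lemma nag_overdamped_growth:
  fixes a :: "nat \<Rightarrow> real"
  assumes \<mu>: "1 - 1 / s\<^sup>2 \<le> \<mu>"
    and "0 \<le> a 0" and "\<rho> * a 0 \<le> a 1"
    and rec: "\<And>t. \<mu> * ((1 + \<gamma>) * a (Suc t) - \<gamma> * a t) \<le> a (Suc (Suc t))"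
  shows "0 \<le> a t \<and> \<rho> * a t \<le> a (Suc t)"
proof (induction t)
  case 0
  then show ?case using assms by simp
next
  case (Suc t)
  from Suc have pos: "0 \<le> a (Suc t)"
    using nag_params(3) mult_nonneg_nonneg[of \<rho> "a t"] by linarith
  have "\<rho> * (\<rho> * a t) \<le> \<rho> * a (Suc t)"
    using Suc nag_params by (intro mult_left_mono) auto
  then have "\<rho> * a (Suc t) \<le> 2 * \<rho> * a (Suc t) - \<rho>\<^sup>2 * a t"
    by (simp add: power2_eq_square mult.assoc)
  also have "\<dots> = (1 - 1 / s\<^sup>2) * ((1 + \<gamma>) * a (Suc t) - \<gamma> * a t)"
    unfolding nag_critical[symmetric] by (simp only: mult.assoc right_diff_distrib)
  also have "\<dots> \<le> \<mu> * ((1 + \<gamma>) * a (Suc t) - \<gamma> * a t)"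
    using nag_extrapolation_nonneg Suc \<mu> by (intro mult_right_mono) auto
  also have "\<dots> \<le> a (Suc (Suc t))" by (rule rec)
  finally show ?case using pos by simp
qed

lemma nag_impulse_overdamped:
  assumes \<mu>: "1 - 1 / s\<^sup>2 \<le> \<mu>"
  shows "0 \<le> nag_impulse \<gamma> \<mu> t \<and> \<rho> * nag_impulse \<gamma> \<mu> t \<le> nag_impulse \<gamma> \<mu> (Suc t)"
proof (rule nag_overdamped_growth[OF \<mu>])
  have "2 * \<rho> \<le> \<mu> * (1 + \<gamma>)"
    unfolding nag_critical(1)[symmetric] using \<mu> nag_params by (intro mult_right_mono) auto
  then have "\<rho> \<le> \<mu> * (1 + \<gamma>)" using nag_params(3) by linarith
  then show "\<rho> * nag_impulse \<gamma> \<mu> 0 \<le> nag_impulse \<gamma> \<mu> 1" by simp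
qed auto

text \<open>The difference of the responses obeys the \<open>\<nu>\<close>-recursion with the extra
  source \<open>\<nu> - \<mu>\<close> times an extrapolated value, which is nonnegative.\<close>

lemma nag_impulse_mono:
  assumes \<mu>: "1 - 1 / s\<^sup>2 \<le> \<mu>" and "\<mu> \<le> \<nu>"
  shows "nag_impulse \<gamma> \<mu> t \<le> nag_impulse \<gamma> \<nu> t"
proof -
  let ?D = "\<lambda>t. nag_impulse \<gamma> \<nu> t - nag_impulse \<gamma> \<mu> t"
  have "0 \<le> ?D t \<and> \<rho> * ?D t \<le> ?D (Suc t)"
  proof (rule nag_overdamped_growth)
    show "1 - 1 / s\<^sup>2 \<le> \<nu>" using assms by linarith
    show "\<rho> * ?D 0 \<le> ?D 1"
      using mult_right_mono[OF \<open>\<mu> \<le> \<nu>\<close>, of "1 + \<gamma>"] nag_params(1) by simp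
    fix t
    let ?E = "(1 + \<gamma>) * nag_impulse \<gamma> \<mu> (Suc t) - \<gamma> * nag_impulse \<gamma> \<mu> t"
    have "\<mu> * ?E \<le> \<nu> * ?E"
      using nag_impulse_overdamped[OF \<mu>, of t] \<open>\<mu> \<le> \<nu>\<close> nag_extrapolation_nonneg
      by (intro mult_right_mono) auto
    then show "\<nu> * ((1 + \<gamma>) * ?D (Suc t) - \<gamma> * ?D t) \<le> ?D (Suc (Suc t))"
      by (simp add: right_diff_distrib)
  qed auto
  then show ?thesis by simp
qed

lemma nag_impulse_critical: "nag_impulse \<gamma> (1 - 1 / s\<^sup>2) t = real (t + 1) * \<rho> ^ t"
proof (induction t rule: induct_nat_012)
  case (ge2 t)
  have "nag_impulse \<gamma> (1 - 1 / s\<^sup>2) (Suc (Suc t)) =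
     (1 - 1 / s\<^sup>2) * (1 + \<gamma>) * nag_impulse \<gamma> (1 - 1 / s\<^sup>2) (Suc t)
     - (1 - 1 / s\<^sup>2) * \<gamma> * nag_impulse \<gamma> (1 - 1 / s\<^sup>2) t"
    by (simp only: nag_impulse.simps right_diff_distrib mult.assoc)
  also have "\<dots> = 2 * \<rho> * (real (Suc t + 1) * \<rho> ^ Suc t) - \<rho>\<^sup>2 * (real (t + 1) * \<rho> ^ t)"
    unfolding nag_critical ge2 ..
  also have "\<dots> = real (Suc (Suc t) + 1) * \<rho> ^ Suc (Suc t)"
    by (simp add: power2_eq_square algebra_simps)
  finally show ?case .
qed (use nag_critical(1) in simp_all)

text \<open>Here the characteristic roots are complex or equal, and the quadratic form
  \<open>x\<^sup>2 - \<mu> (1 + \<gamma>) x y + \<gamma> \<mu> y\<^sup>2\<close> in two consecutive values contracts by exactly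
  \<open>\<gamma> \<mu>\<close> in every step; completing the square replaces trigonometry.\<close>

lemma nag_impulse_underdamped:
  assumes "0 \<le> \<mu>" and "\<mu> \<le> 1 - 1 / s\<^sup>2"
  shows "\<bar>nag_impulse \<gamma> \<mu> t\<bar> \<le> real (t + 1) * \<rho> ^ t"
proof -
  define p where "p = nag_impulse \<gamma> \<mu>"
  define a where "a = \<mu> * (1 + \<gamma>)"
  define b where "b = \<mu> * \<gamma>"
  have p: "p 0 = 1" "p 1 = a" "p (Suc (Suc t)) = a * p (Suc t) - b * p t" for t
    by (simp_all add: p_def a_def b_def algebra_simps)
  have a: "0 \<le> a" "a / 2 \<le> \<rho>"
    using assms nag_params nag_critical(1) mult_right_mono[of \<mu> "1 - 1 / s\<^sup>2" "1 + \<gamma>"]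
    by (auto simp: a_def)
  have b: "0 \<le> b" "b \<le> \<rho>\<^sup>2"
    using assms nag_params nag_critical(2) mult_right_mono[of \<mu> "1 - 1 / s\<^sup>2" "\<gamma>"]
    by (auto simp: b_def)
  \<comment> \<open>The roots are not real and distinct: by critical damping
    \<open>4 \<gamma>\<close> equals the critical \<open>\<mu>\<close> times
    \<open>(1 + \<gamma>)^2\<close>, and a smaller \<open>\<mu>\<close> lowers the discriminant's
    sign.\<close>
  have disc: "a\<^sup>2 / 4 \<le> b"
  proof -
    have "\<mu> * (1 + \<gamma>)\<^sup>2 \<le> (1 - 1 / s\<^sup>2) * (1 + \<gamma>)\<^sup>2"
      using assms by (intro mult_right_mono) auto
    also have "\<dots> = 4 * \<gamma>"
      using s unfolding \<gamma> by (simp add: divide_simps power2_eq_square) (simp add: algebra_simps)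
    finally have "\<mu> * (\<mu> * (1 + \<gamma>)\<^sup>2) \<le> \<mu> * (4 * \<gamma>)"
      using assms by (intro mult_left_mono)
    then show ?thesis by (simp add: a_def b_def power2_eq_square algebra_simps)
  qed
  have inv: "(p (Suc t))\<^sup>2 - a * p (Suc t) * p t + b * (p t)\<^sup>2 = b ^ Suc t" for t
  proof (induction t)
    case 0
    then show ?case using p(1,2) by (simp add: power2_eq_square)
  next
    case (Suc t)
    have "(p (Suc (Suc t)))\<^sup>2 - a * p (Suc (Suc t)) * p (Suc t) + b * (p (Suc t))\<^sup>2
      = b * ((p (Suc t))\<^sup>2 - a * p (Suc t) * p t + b * (p t)\<^sup>2)"
      unfolding p(3) by (simp add: power2_eq_square algebra_simps)
    then show ?case using Suc by simp
  qed
  have step: "\<bar>p (Suc t) - a / 2 * p t\<bar> \<le> \<rho> ^ Suc t" for t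
  proof (rule abs_le_square_iff[THEN iffD2, of _ "\<rho> ^ Suc t", unfolded abs_of_nonneg[OF zero_le_power[OF nag_params(3)]]])
    have "(p (Suc t) - a / 2 * p t)\<^sup>2 + (b - a\<^sup>2 / 4) * (p t)\<^sup>2 = b ^ Suc t"
      unfolding inv[symmetric] by (simp add: power2_eq_square algebra_simps)
    moreover have "0 \<le> (b - a\<^sup>2 / 4) * (p t)\<^sup>2" using disc by simp
    ultimately have "(p (Suc t) - a / 2 * p t)\<^sup>2 \<le> b ^ Suc t" by linarith
    also have "\<dots> \<le> (\<rho>\<^sup>2) ^ Suc t" using b by (intro power_mono)
    finally show "(p (Suc t) - a / 2 * p t)\<^sup>2 \<le> (\<rho> ^ Suc t)\<^sup>2"
      by (simp only: power_mult[symmetric] mult.commute)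
  qed
  \<comment> \<open>Since \<open>a / 2 \<le> \<rho>\<close>, each step multiplies the bound by
    \<open>\<rho>\<close> and adds one more \<open>\<rho> ^ Suc t\<close>; hence the factor
    \<open>t + 1\<close>.\<close>
  have "\<bar>p t\<bar> \<le> real (t + 1) * \<rho> ^ t"
  proof (induction t)
    case (Suc t)
    have "\<bar>p (Suc t)\<bar> \<le> a / 2 * \<bar>p t\<bar> + \<rho> ^ Suc t"
      using step[of t] abs_triangle_ineq[of "p (Suc t) - a / 2 * p t" "a / 2 * p t"] a(1)
      by (simp add: abs_mult)
    also have "a / 2 * \<bar>p t\<bar> \<le> \<rho> * (real (t + 1) * \<rho> ^ t)"
      using Suc a nag_params by (intro mult_mono) auto
    finally show ?case by (simp add: algebra_simps)
  qed (simp add: p)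
  then show ?thesis by (simp add: p_def)
qed

text \<open>The two regimes meet at the critical mode, whose response is exactly the underdamped
  bound; from there on monotonicity in \<open>\<mu>\<close> takes over.\<close>

lemma nag_impulse_abs_le:
  assumes "0 \<le> \<mu>" and "\<mu> \<le> \<nu>" and \<nu>: "1 - 1 / s\<^sup>2 \<le> \<nu>"
  shows "\<bar>nag_impulse \<gamma> \<mu> t\<bar> \<le> nag_impulse \<gamma> \<nu> t"
proof (cases "\<mu> \<le> 1 - 1 / s\<^sup>2")
  case True
  then show ?thesis
    using nag_impulse_underdamped[OF \<open>0 \<le> \<mu>\<close>, of t] nag_impulse_mono[OF order_refl \<nu>, of t]
    by (simp add: nag_impulse_critical)
next
  case False
  then show ?thesis
    using nag_impulse_mono[OF _ \<open>\<mu> \<le> \<nu>\<close>, of t] nag_impulse_overdamped[of \<mu> t] by auto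
qed

text \<open>The partial sums \<open>S\<close> respond to the constant input 1, so the defect
  \<open>1 - (1 - \<mu>) S\<close> solves the homogeneous recursion with initial values 1 and
  \<open>\<mu>\<close>. By the growth lemma it loses at most a factor \<open>\<rho>\<close> per
  step.\<close>

lemma nag_impulse_sum_le:
  assumes \<mu>: "1 - 1 / s\<^sup>2 \<le> \<mu>"
  shows "(1 - \<mu>) * (\<Sum>t<T. nag_impulse \<gamma> \<mu> t) \<le> 1 - \<rho> ^ T"
proof -
  define p where "p = nag_impulse \<gamma> \<mu>"
  define S where "S t = sum p {..<t}" for t
  define d where "d t = 1 - (1 - \<mu>) * S t" for t
  have S_Suc: "S (Suc t) = S t + p t" for t by (simp add: S_def)
  have S: "S (Suc (Suc t)) = 1 + \<mu> * ((1 + \<gamma>) * S (Suc t) - \<gamma> * S t)" for t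
  proof (induction t)
    case (Suc t)
    have "S (Suc (Suc (Suc t))) = S (Suc (Suc t)) + p (Suc (Suc t))"
      by (rule S_Suc)
    also have "\<dots> = 1 + \<mu> * ((1 + \<gamma>) * S (Suc t) - \<gamma> * S t)
        + \<mu> * ((1 + \<gamma>) * p (Suc t) - \<gamma> * p t)"
      unfolding Suc by (simp add: p_def)
    also have "\<dots> = 1 + \<mu> * ((1 + \<gamma>) * (S (Suc t) + p (Suc t)) - \<gamma> * (S t + p t))"
      by (simp add: algebra_simps)
    finally show ?case by (simp only: S_Suc)
  qed (simp add: S_def p_def)
  have d: "0 \<le> d t \<and> \<rho> * d t \<le> d (Suc t)" for t
  proof (rule nag_overdamped_growth[OF \<mu>])
    show "\<rho> * d 0 \<le> d 1" using \<mu> nag_params(4) by (simp add: d_def S_def p_def)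
    show "\<mu> * ((1 + \<gamma>) * d (Suc t) - \<gamma> * d t) \<le> d (Suc (Suc t))" for t
      unfolding d_def S by (simp only: algebra_simps order_refl)
  qed (simp add: d_def S_def)
  have "\<rho> ^ T \<le> d T"
  proof (induction T)
    case (Suc T)
    have "\<rho> * \<rho> ^ T \<le> \<rho> * d T" using nag_params Suc by (intro mult_left_mono) auto
    then show ?case using d[of T] by simp
  qed (simp add: d_def S_def)
  then show ?thesis by (simp add: d_def S_def p_def)
qed

end

section \<open>Diagonalising a symmetric form on a subspace\<close>

text \<open>A maximiser of the Rayleigh quotient on the unit sphere of \<open>V\<close> is the first
  basis vector, and induction handles its orthogonal complement in \<open>V\<close>. As
  \<open>f\<close> may map \<open>V\<close> outside itself, the form is diagonalised rather than
  \<open>f\<close>: the basis need not consist of eigenvectors.\<close>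

lemma symmetric_form_orthonormal_basis:
  fixes f :: "'a::euclidean_space \<Rightarrow> 'a"
  assumes "linear f" and sym: "\<And>x y. x \<bullet> f y = f x \<bullet> y" and "subspace V"
  shows "\<exists>B. finite B \<and> pairwise orthogonal B \<and> (\<forall>b\<in>B. norm b = 1) \<and> span B = V \<and>
    (\<forall>b\<in>B. \<forall>c\<in>B. b \<noteq> c \<longrightarrow> b \<bullet> f c = 0)"
  using \<open>subspace V\<close>
proof (induction "dim V" arbitrary: V rule: less_induct)
  case less
  interpret f: linear f by fact
  show ?case
  proof (cases "V = {0}")
    case True
    then show ?thesis by (intro exI[of _ "{}"]) auto
  next
    case False
    then obtain v0 where v0: "v0 \<in> V" "v0 \<noteq> 0"
      using subspace_0[OF less.prems] by blast
    let ?K = "V \<inter> sphere 0 1"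
    have "compact ?K" using closed_subspace[OF less.prems] by (simp add: closed_Int_compact)
    moreover have "v0 /\<^sub>R norm v0 \<in> ?K"
      using v0 less.prems by (simp add: subspace_scale)
    moreover have "continuous_on ?K (\<lambda>x. x \<bullet> f x)"
      by (intro continuous_intros linear_continuous_on linear_linear[THEN iffD2] \<open>linear f\<close>)
    ultimately have "\<exists>x\<in>?K. \<forall>y\<in>?K. y \<bullet> f y \<le> x \<bullet> f x"
      by (intro continuous_attains_sup) auto
    then obtain x where x: "x \<in> V" "norm x = 1"
      and max: "\<And>y. y \<in> ?K \<Longrightarrow> y \<bullet> f y \<le> x \<bullet> f x"
      by auto
    let ?m = "x \<bullet> f x"
    have max': "y \<bullet> f y \<le> ?m * (y \<bullet> y)" if "y \<in> V" for y
    proof (cases "y = 0")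
      case False
      have "y /\<^sub>R norm y \<in> ?K" using that less.prems False by (simp add: subspace_scale)
      from max[OF this] have "(y \<bullet> f y) / (norm y)\<^sup>2 \<le> ?m"
        by (simp add: f.scale power2_eq_square divide_simps)
      then show ?thesis using False by (simp add: divide_simps dot_square_norm)
    qed simp
    \<comment> \<open>First-order condition: comparing \<open>x\<close> with \<open>x + t v\<close>
      for all \<open>t\<close> forces the linear term in \<open>t\<close> to vanish.\<close>
    have crit: "v \<bullet> f x = 0" if "v \<in> V" "v \<bullet> x = 0" for v
    proof -
      let ?c = "v \<bullet> f x" and ?k = "?m * (v \<bullet> v) - v \<bullet> f v"
      have le: "2 * t * ?c \<le> t\<^sup>2 * ?k" for t
      proof -
        have "x + t *\<^sub>R v \<in> V" using x that less.prems by (simp add: subspace_add subspace_scale)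
        from max'[OF this] show ?thesis
          using that x sym[of x v]
          by (simp add: f.add f.scale inner_simps inner_commute power2_eq_square
              norm_eq_1 algebra_simps)
      qed
      show ?thesis
      proof (rule ccontr)
        assume c: "?c \<noteq> 0"
        \<comment> \<open>The step \<open>t = ?c / q\<close> is short enough for the linear term to
          beat the quadratic one; the added 1 keeps \<open>q\<close> positive.\<close>
        define q where "q = \<bar>?k\<bar> + 1"
        have q: "0 < q" "?k < q" by (auto simp: q_def)
        from le[of "?c / q"] q have "2 * ?c\<^sup>2 * q \<le> ?c\<^sup>2 * ?k"
          by (simp add: divide_simps power2_eq_square mult.assoc)
        also have "\<dots> \<le> ?c\<^sup>2 * q" using q by (intro mult_left_mono) auto
        finally show False using c q by simp
      qed
    qed
    let ?W = "{v \<in> V. v \<bullet> x = 0}"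
    have W: "subspace ?W"
      using less.prems by (auto simp: subspace_def inner_simps)
    have "x \<notin> ?W" using x by auto
    then have "?W \<subset> V" using x by blast
    then have "dim ?W < dim V"
      using W less.prems by (intro dim_psubset) (simp add: span_eq_iff[THEN iffD2])
    from less.hyps[OF this W] obtain B where B: "finite B" "pairwise orthogonal B"
      "\<forall>b\<in>B. norm b = 1" "span B = ?W" "\<forall>b\<in>B. \<forall>c\<in>B. b \<noteq> c \<longrightarrow> b \<bullet> f c = 0"
      by blast
    have BW: "b \<in> ?W" if "b \<in> B" for b using B(4) that span_base by blast
    have "span (insert x B) = V"
    proof
      show "span (insert x B) \<subseteq> V"
        using BW x less.prems by (intro span_minimal) auto
      show "V \<subseteq> span (insert x B)"
      proof
        fix v assume v: "v \<in> V"
        have "v - (v \<bullet> x) *\<^sub>R x \<in> ?W"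
          using v x less.prems by (simp add: subspace_diff subspace_scale inner_simps norm_eq_1)
        then show "v \<in> span (insert x B)"
          unfolding B(4)[symmetric] span_insert by blast
      qed
    qed
    moreover have "pairwise orthogonal (insert x B)"
      using B(2) BW by (auto simp: pairwise_insert orthogonal_def inner_commute)
    moreover have "b \<bullet> f c = 0" if "b \<in> insert x B" "c \<in> insert x B" "b \<noteq> c" for b c
      using that B(5) BW crit sym[of x] by (auto simp: inner_commute)
    ultimately show ?thesis
      using B(1,3) x by (intro exI[of _ "insert x B"]) auto
  qed
qed


section \<open>The perturbed vector recursion\<close>

text \<open>The input \<open>d\<close> is controlled only when paired with \<open>V\<close>, and
  \<open>H\<close> may leave \<open>V\<close>. Since the states lie in \<open>V\<close>, they are
  determined by their coordinates in an orthonormal basis of \<open>V\<close>, and these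
  decouple.\<close>

lemma nag_perturbation_bound:
  fixes H :: "'a::euclidean_space \<Rightarrow> 'a" and x y d :: "nat \<Rightarrow> 'a"
  assumes "linear H" and sym: "\<And>u v. u \<bullet> H v = H u \<bullet> v" and "subspace V"
    and \<alpha>: "0 < \<alpha>" and \<eta>: "0 < \<eta>" "\<eta> \<le> 1 / \<beta>" and \<beta>: "\<alpha> \<le> \<beta>"
    and lower: "\<And>v. \<alpha> * (v \<bullet> v) \<le> v \<bullet> H v" and upper: "\<And>v. v \<bullet> H v \<le> \<beta> * (v \<bullet> v)"
    and x0: "x 0 = 0" and y0: "y 0 = 0"
    and x_Suc: "\<And>t. x (Suc t) = y t - \<eta> *\<^sub>R (H (y t) + d t)"
    and y_Suc: "\<And>t. y (Suc t) = (1 + nag_momentum (\<beta> / \<alpha>)) *\<^sub>R x (Suc t)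
                               - nag_momentum (\<beta> / \<alpha>) *\<^sub>R x t"
    and xV: "\<And>t. x t \<in> V"
    and "0 \<le> D" and d: "\<And>t v. v \<in> V \<Longrightarrow> \<bar>d t \<bullet> v\<bar> \<le> D * norm v"
  shows "norm (x T) \<le> D / \<alpha> * (1 - (1 - 1 / sqrt (\<beta> / \<alpha>)) ^ T)"
proof -
  define s where "s = sqrt (\<beta> / \<alpha>)"
  define \<gamma> where "\<gamma> = nag_momentum (\<beta> / \<alpha>)"
  define \<nu> where "\<nu> = 1 - \<eta> * \<alpha>"
  have s: "1 \<le> s" "s\<^sup>2 = \<beta> / \<alpha>" using \<alpha> \<beta> by (auto simp: s_def)
  have \<gamma>: "\<gamma> = (s - 1) / (s + 1)" by (simp add: \<gamma>_def s_def nag_momentum_def)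
  interpret H: linear H by fact
  obtain B where B: "finite B" "pairwise orthogonal B" "\<And>b. b \<in> B \<Longrightarrow> norm b = 1" "span B = V"
      "\<And>b c. b \<in> B \<Longrightarrow> c \<in> B \<Longrightarrow> b \<noteq> c \<Longrightarrow> b \<bullet> H c = 0"
    using symmetric_form_orthonormal_basis[OF \<open>linear H\<close> sym \<open>subspace V\<close>] by blast
  define \<mu> where "\<mu> b = 1 - \<eta> * (b \<bullet> H b)" for b
  have BV: "b \<in> V" if "b \<in> B" for b using that B(4) span_base by blast
  have expand: "(\<Sum>b\<in>B. (v \<bullet> b) *\<^sub>R b) = v" if "v \<in> V" for v
    using that B by (intro orthonormal_basis_expand) auto
  have coord: "H v \<bullet> b = (b \<bullet> H b) * (v \<bullet> b)" if "v \<in> V" "b \<in> B" for v b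
  proof -
    have "H v \<bullet> b = (\<Sum>c\<in>B. (v \<bullet> c) * (H c \<bullet> b))"
      by (subst expand[OF \<open>v \<in> V\<close>, symmetric])
        (simp add: H.sum H.scale inner_sum_left)
    also have "\<dots> = (\<Sum>c\<in>B. if c = b then (v \<bullet> b) * (b \<bullet> H b) else 0)"
      using B(5)[OF that(2)] by (intro sum.cong) (auto simp: inner_commute)
    finally show ?thesis using that B(1) by simp
  qed
  have norm_coords: "norm (\<Sum>b\<in>B. a b *\<^sub>R b) = sqrt (\<Sum>b\<in>B. (a b)\<^sup>2)" for a
  proof -
    have "(norm (\<Sum>b\<in>B. a b *\<^sub>R b))\<^sup>2 = (\<Sum>b\<in>B. (norm (a b *\<^sub>R b))\<^sup>2)"
      using B(1,2) by (intro norm_sum_Pythagorean)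
        (auto simp: pairwise_def orthogonal_def)
    also have "\<dots> = (\<Sum>b\<in>B. (a b)\<^sup>2)"
      using B(3) by (intro sum.cong) auto
    finally show ?thesis by (metis norm_ge_zero real_sqrt_unique)
  qed
  have yV: "y t \<in> V" for t
  proof (cases t)
    case 0
    then show ?thesis using y0 \<open>subspace V\<close> by (simp add: subspace_0)
  next
    case (Suc m)
    then show ?thesis
      using y_Suc[of m] xV \<open>subspace V\<close> by (simp add: subspace_diff subspace_scale)
  qed
  \<comment> \<open>The step-size condition puts the slowest mode at or above critical
    damping.\<close>
  have "1 / s\<^sup>2 = \<alpha> / \<beta>" using s by simp
  moreover have "\<eta> * \<alpha> \<le> \<alpha> / \<beta>"
    using mult_right_mono[OF \<eta>(2), of \<alpha>] \<alpha> by simp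
  ultimately have \<nu>: "1 - 1 / s\<^sup>2 \<le> \<nu>" by (simp add: \<nu>_def)
  have \<mu>: "0 \<le> \<mu> b" "\<mu> b \<le> \<nu>" if "b \<in> B" for b
  proof -
    have "b \<bullet> b = 1" using B(3)[OF that] by (simp add: norm_eq_1)
    then have "\<alpha> \<le> b \<bullet> H b" "b \<bullet> H b \<le> \<beta>" using lower[of b] upper[of b] by auto
    then have "\<eta> * \<alpha> \<le> \<eta> * (b \<bullet> H b)" "\<eta> * (b \<bullet> H b) \<le> \<eta> * \<beta>"
      using \<eta> by (auto intro: mult_left_mono)
    moreover have "\<eta> * \<beta> \<le> 1" using \<eta>(2) \<alpha> \<beta> by (simp add: field_simps)
    ultimately show "0 \<le> \<mu> b" "\<mu> b \<le> \<nu>" by (auto simp: \<mu>_def \<nu>_def)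
  qed
  let ?p = "nag_impulse \<gamma>"
  have conv: "x T \<bullet> b = (\<Sum>j<T. ?p (\<mu> b) (T - 1 - j) * (- \<eta> * (d j \<bullet> b)))" if "b \<in> B" for b
  proof (rule nag_impulse_convolution)
    have step: "x (Suc t) \<bullet> b = \<mu> b * (y t \<bullet> b) + (- \<eta> * (d t \<bullet> b))" for t
      unfolding x_Suc using coord[OF yV that, of t] by (simp add: \<mu>_def inner_simps algebra_simps)
    show "x 0 \<bullet> b = 0" using x0 by simp
    show "x 1 \<bullet> b = - \<eta> * (d 0 \<bullet> b)" using step[of 0] y0 by simp
    show "x (Suc (Suc t)) \<bullet> b =
        \<mu> b * ((1 + \<gamma>) * (x (Suc t) \<bullet> b) - \<gamma> * (x t \<bullet> b)) + - \<eta> * (d (Suc t) \<bullet> b)" for t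
      unfolding step[of "Suc t"] y_Suc \<gamma>_def by (simp add: inner_diff_left)
  qed
  \<comment> \<open>Testing \<open>d j\<close> against its own projection \<open>e\<close> onto
    \<open>V\<close> turns the bound on pairings into a bound on the norm of
    \<open>e\<close>.\<close>
  have proj: "sqrt (\<Sum>b\<in>B. (d j \<bullet> b)\<^sup>2) \<le> D" for j
  proof -
    define e where "e = (\<Sum>b\<in>B. (d j \<bullet> b) *\<^sub>R b)"
    have "e \<in> V"
      unfolding e_def using BV \<open>subspace V\<close> by (intro subspace_sum subspace_scale)
    have "(norm e)\<^sup>2 = d j \<bullet> e"
      unfolding e_def norm_coords
      by (simp add: sum_nonneg inner_sum_right power2_eq_square)
    also have "\<dots> \<le> D * norm e" using d[OF \<open>e \<in> V\<close>, of j] by linarith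
    finally have "norm e \<le> D"
      using \<open>0 \<le> D\<close> by (cases "e = 0") (auto simp: power2_eq_square)
    then show ?thesis unfolding e_def norm_coords .
  qed
  \<comment> \<open>All coordinates share the factor \<open>?p \<nu> i\<close>, so the Euclidean
    norm is bounded without any dependence on the dimension.\<close>
  have bound: "norm (\<Sum>b\<in>B. (?p (\<mu> b) i * (- \<eta> * (d j \<bullet> b))) *\<^sub>R b) \<le> \<eta> * D * ?p \<nu> i" for i j
  proof -
    have p: "0 \<le> ?p \<nu> i"
      using nag_impulse_overdamped[OF s(1) \<gamma> refl \<nu>] by simp
    have "(\<Sum>b\<in>B. (?p (\<mu> b) i * (- \<eta> * (d j \<bullet> b)))\<^sup>2)
        \<le> (\<Sum>b\<in>B. (\<eta> * ?p \<nu> i)\<^sup>2 * (d j \<bullet> b)\<^sup>2)"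
    proof (rule sum_mono)
      fix b assume b: "b \<in> B"
      have "\<bar>?p (\<mu> b) i\<bar> \<le> ?p \<nu> i"
        by (rule nag_impulse_abs_le[OF s(1) \<gamma> refl \<mu>[OF b] \<nu>])
      then have "(?p (\<mu> b) i)\<^sup>2 \<le> (?p \<nu> i)\<^sup>2"
        using p by (simp add: abs_le_square_iff[symmetric])
      then have "(?p (\<mu> b) i)\<^sup>2 * (\<eta> * (d j \<bullet> b))\<^sup>2 \<le> (?p \<nu> i)\<^sup>2 * (\<eta> * (d j \<bullet> b))\<^sup>2"
        by (intro mult_right_mono) auto
      then show "(?p (\<mu> b) i * (- \<eta> * (d j \<bullet> b)))\<^sup>2 \<le> (\<eta> * ?p \<nu> i)\<^sup>2 * (d j \<bullet> b)\<^sup>2"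
        by (simp add: power_mult_distrib mult_ac)
    qed
    then have "norm (\<Sum>b\<in>B. (?p (\<mu> b) i * (- \<eta> * (d j \<bullet> b))) *\<^sub>R b)
        \<le> sqrt ((\<eta> * ?p \<nu> i)\<^sup>2 * (\<Sum>b\<in>B. (d j \<bullet> b)\<^sup>2))"
      unfolding norm_coords by (simp only: real_sqrt_le_iff sum_distrib_left)
    also have "\<dots> = \<eta> * ?p \<nu> i * sqrt (\<Sum>b\<in>B. (d j \<bullet> b)\<^sup>2)"
      using p \<eta>(1) by (simp add: real_sqrt_mult)
    also have "\<dots> \<le> \<eta> * ?p \<nu> i * D"
      using p \<eta>(1) proj by (intro mult_left_mono) auto
    finally show ?thesis by (simp add: mult_ac)
  qed
  have "x T = (\<Sum>b\<in>B. (x T \<bullet> b) *\<^sub>R b)" using expand[OF xV] by simp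
  also have "\<dots> = (\<Sum>b\<in>B. \<Sum>j<T. (?p (\<mu> b) (T - 1 - j) * (- \<eta> * (d j \<bullet> b))) *\<^sub>R b)"
    by (intro sum.cong refl) (simp only: conv scaleR_sum_left)
  also have "\<dots> = (\<Sum>j<T. \<Sum>b\<in>B. (?p (\<mu> b) (T - 1 - j) * (- \<eta> * (d j \<bullet> b))) *\<^sub>R b)"
    by (rule sum.swap)
  finally have "norm (x T) = norm (\<Sum>j<T. \<Sum>b\<in>B. (?p (\<mu> b) (T - 1 - j) * (- \<eta> * (d j \<bullet> b))) *\<^sub>R b)"
    by (rule arg_cong)
  also have "\<dots> \<le> (\<Sum>j<T. \<eta> * D * ?p \<nu> (T - 1 - j))"
    by (intro sum_norm_le bound)
  also have "\<dots> = \<eta> * D * (\<Sum>j<T. ?p \<nu> j)"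
    using sum.nat_diff_reindex[of "?p \<nu>" T] by (simp add: sum_distrib_left[symmetric])
  \<comment> \<open>Here \<open>1 - \<nu> = \<eta> \<alpha>\<close>, so the step size
    cancels.\<close>
  also have "\<dots> = D / \<alpha> * ((1 - \<nu>) * (\<Sum>j<T. ?p \<nu> j))"
    using \<alpha> by (simp add: \<nu>_def)
  also have "\<dots> \<le> D / \<alpha> * (1 - (1 - 1 / s) ^ T)"
    using nag_impulse_sum_le[OF s(1) \<gamma> refl \<nu>] \<alpha> \<open>0 \<le> D\<close> by (intro mult_left_mono) auto
  finally show ?thesis by (simp add: s_def)
qed

section \<open>Gradients and Hessians of the losses\<close>

text \<open>The set may have empty interior, in which case the Lipschitz condition says nothing about
  the components of the gradient orthogonal to its affine hull.\<close>

lemma lipschitz_quadratic_gradient_bound: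
  fixes f :: "'a::euclidean_space \<Rightarrow> real"
  assumes "convex \<Omega>" and "w \<in> \<Omega>" and "w0 \<in> \<Omega>" and lip: "L-lipschitz_on \<Omega> f"
    and "linear K"
    and f: "\<And>x h. f (x + h) = f x + (K x + b) \<bullet> h + h \<bullet> K h / 2"
    and v: "v \<in> span ((\<lambda>x. - w0 + x) ` \<Omega>)"
  shows "\<bar>(K w + b) \<bullet> v\<bar> \<le> L * norm v"
proof -
  interpret K: linear K by fact
  let ?V = "span ((\<lambda>x. - w0 + x) ` \<Omega>)"
  have hull: "affine hull \<Omega> = (\<lambda>x. w0 + x) ` ?V"
    using \<open>w0 \<in> \<Omega>\<close> by (intro affine_hull_span_gen hull_inc)
  obtain p e where p: "p \<in> \<Omega>" "0 < e" "ball p e \<inter> affine hull \<Omega> \<subseteq> \<Omega>"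
    using \<open>convex \<Omega>\<close> \<open>w \<in> \<Omega>\<close> rel_interior_eq_empty[of \<Omega>] mem_rel_interior_ball by blast
  \<comment> \<open>Small enough that \<open>p + h v\<close> stays in the ball around
    \<open>p\<close>; the added 1 covers \<open>v = 0\<close>.\<close>
  define h where "h = e / (norm v + 1)"
  have h: "0 < h" using p by (simp add: h_def add_nonneg_pos)
  have "h * norm v < e" using p by (simp add: h_def divide_simps add_nonneg_pos)
  have "- w0 + p \<in> ?V" using p by (intro span_base) auto
  then have "- w0 + p + h *\<^sub>R v \<in> ?V" by (rule span_add[OF _ span_scale[OF v]])
  then have "w0 + (- w0 + p + h *\<^sub>R v) \<in> affine hull \<Omega>" unfolding hull by (rule imageI)
  then have q: "p + h *\<^sub>R v \<in> \<Omega>"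
    using p(3) \<open>h * norm v < e\<close> h by (auto simp: dist_norm)
  let ?c = "(K w + b) \<bullet> v" and ?d = "K (p - w) \<bullet> v + h / 2 * (v \<bullet> K v)"
  \<comment> \<open>Since \<open>w\<close> may lie on the relative boundary, the difference quotient
    along \<open>v\<close> is taken at \<open>w + s (p - w)\<close>. Shrinking \<open>p\<close> and
    \<open>p + h v\<close> towards \<open>w\<close> by the factor \<open>s\<close> keeps both in
    \<open>\<Omega>\<close>, and the error \<open>s * ?d\<close> vanishes with
    \<open>s\<close>.\<close>
  have segment: "\<bar>?c + s * ?d\<bar> \<le> L * norm v" if s: "0 < s" "s \<le> 1" for s
  proof -
    let ?x = "w + s *\<^sub>R (p - w)"
    have "(1 - s) *\<^sub>R w + s *\<^sub>R p \<in> \<Omega>" "(1 - s) *\<^sub>R w + s *\<^sub>R (p + h *\<^sub>R v) \<in> \<Omega>"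
      using s p q \<open>w \<in> \<Omega>\<close> \<open>convex \<Omega>\<close> by (auto intro!: convexD_alt)
    then have "?x \<in> \<Omega>" "?x + (s * h) *\<^sub>R v \<in> \<Omega>" by (simp_all add: algebra_simps)
    then have "\<bar>f (?x + (s * h) *\<^sub>R v) - f ?x\<bar> \<le> L * ((s * h) * norm v)"
      using lipschitz_onD[OF lip, of "?x + (s * h) *\<^sub>R v" ?x] s h by (simp add: dist_norm)
    moreover have "f (?x + (s * h) *\<^sub>R v) - f ?x = (s * h) * (?c + s * ?d)"
      unfolding f[of ?x "(s * h) *\<^sub>R v"]
      by (simp only: K.add K.scale inner_add_left inner_add_right inner_scaleR_left inner_scaleR_right)
        (simp add: algebra_simps)
    ultimately have "(s * h) * \<bar>?c + s * ?d\<bar> \<le> (s * h) * (L * norm v)"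
      using s h by (simp add: abs_mult mult_ac)
    then show ?thesis using s h by simp
  qed
  show ?thesis
  proof (rule field_le_epsilon)
    fix \<epsilon> :: real assume "0 < \<epsilon>"
    define s where "s = min 1 (\<epsilon> / (\<bar>?d\<bar> + 1))"
    have nz: "\<bar>?d\<bar> + 1 \<noteq> 0" by linarith
    have s: "0 < s" "s \<le> 1" using \<open>0 < \<epsilon>\<close> by (auto simp: s_def)
    have "s * \<bar>?d\<bar> \<le> \<epsilon> / (\<bar>?d\<bar> + 1) * (\<bar>?d\<bar> + 1)"
      using \<open>0 < \<epsilon>\<close> s by (intro mult_mono) (auto simp: s_def)
    also have "\<dots> = \<epsilon>" using nz by (rule nonzero_eq_divide_eq[THEN iffD1, OF _ refl])
    finally have "\<bar>s * ?d\<bar> \<le> \<epsilon>" using s by (simp add: abs_mult)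
    then show "\<bar>?c\<bar> \<le> L * norm v + \<epsilon>" using segment[OF s] by linarith
  qed
qed

lemma mat_vector_mult: "(mat a :: real ^ 'd ^ 'd) *v v = a *\<^sub>R v"
proof -
  have "(mat a :: real ^ 'd ^ 'd) *v v = (a *\<^sub>R mat 1) *v v"
    by (rule arg_cong[where f = "\<lambda>M. M *v v"]) (simp add: mat_def vec_eq_iff)
  then show ?thesis by (simp add: scaleR_matrix_vector_assoc[symmetric])
qed

text \<open>Strong convexity and smoothness each assert a Hessian of their own; uniqueness of
  derivatives identifies both with \<open>A + transpose A\<close>, whose symmetry gives the exact
  Taylor expansion.\<close>

lemma quadratic_gradient_hessian:
  fixes f :: "real ^ 'd \<Rightarrow> real"
  assumes convex: "quadratic_strongly_convex \<alpha> f" and smooth: "quadratic_smooth \<beta> f"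
  obtains K b where "\<And>x y. x \<bullet> (K *v y) = (K *v x) \<bullet> y"
    and "\<And>x. GDERIV f x :> K *v x + b"
    and "\<And>x h. f (x + h) = f x + (K *v x + b) \<bullet> h + h \<bullet> (K *v h) / 2"
    and "\<And>v. \<alpha> * (v \<bullet> v) \<le> v \<bullet> (K *v v)" and "\<And>v. v \<bullet> (K *v v) \<le> \<beta> * (v \<bullet> v)"
proof -
  obtain A b c where "\<forall>x. f x = x \<bullet> (A *v x) + b \<bullet> x + c"
    using convex unfolding quadratic_strongly_convex_def quadratic_def by blast
  then have f: "f = (\<lambda>x. x \<bullet> (A *v x) + b \<bullet> x + c)" by (intro ext) (rule spec)
  define K where "K = A + transpose A"
  have Kx: "K *v x = A *v x + transpose A *v x" for x
    by (simp add: K_def matrix_vector_mult_add_rdistrib)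
  have tr: "x \<bullet> (transpose A *v y) = (A *v x) \<bullet> y" for x y
    by (metis dot_lmul_matrix inner_commute transpose_matrix_vector)
  have hess: "M *v v = K *v v" if "has_constant_hessian f M" for M v
  proof -
    have "has_constant_hessian f K" unfolding f K_def by (rule has_constant_hessian_quadratic)
    then have "(*v) M = (*v) K"
      using that has_derivative_unique unfolding has_constant_hessian_def by blast
    then show ?thesis by (rule fun_cong)
  qed
  show ?thesis
  proof
    show "x \<bullet> (K *v y) = (K *v x) \<bullet> y" for x y
      using tr[of x y] tr[of y x] by (simp add: Kx inner_simps inner_commute)
    show "GDERIV f x :> K *v x + b" for x
      unfolding f K_def by (rule gderiv_quadratic)
    show "f (x + h) = f x + (K *v x + b) \<bullet> h + h \<bullet> (K *v h) / 2" for x h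
      unfolding f Kx using tr[of x h] tr[of h x] tr[of h h]
      by (simp add: matrix_vector_right_distrib inner_simps inner_commute)
    show "\<alpha> * (v \<bullet> v) \<le> v \<bullet> (K *v v)" for v
      using convex hess
      by (auto simp: quadratic_strongly_convex_def loewner_le_def mat_vector_mult)
    show "v \<bullet> (K *v v) \<le> \<beta> * (v \<bullet> v)" for v
      using smooth hess
      by (auto simp: quadratic_smooth_def loewner_le_def mat_vector_mult)
  qed
qed


section \<open>Comparing the runs on two neighbouring samples\<close>

theorem theorem14:
  fixes \<Omega> :: "(real ^ 'd) set"
    and P :: "'z measure"
    and l :: "real ^ 'd \<Rightarrow> 'z \<Rightarrow> real"
    and \<alpha> \<beta> L \<eta> \<kappa> :: real
    and w0 :: "real ^ 'd"
    and n T :: nat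
  assumes "convex \<Omega>"
    and "prob_space P"
    and "0 < \<alpha>" and "\<alpha> \<le> \<beta>"
    and "\<kappa> = \<beta> / \<alpha>"
    and "\<And>z. z \<in> space P \<Longrightarrow> quadratic (\<lambda>\<theta>. l \<theta> z)"
    and "\<And>z. z \<in> space P \<Longrightarrow> quadratic_strongly_convex \<alpha> (\<lambda>\<theta>. l \<theta> z)"
    and "\<And>z. z \<in> space P \<Longrightarrow> quadratic_smooth \<beta> (\<lambda>\<theta>. l \<theta> z)"
    and "\<And>z. z \<in> space P \<Longrightarrow> L-lipschitz_on \<Omega> (\<lambda>\<theta>. l \<theta> z)"
    and "n \<ge> 1" and "T \<ge> 1"
    and "0 < \<eta>" and "\<eta> \<le> 1 / \<beta>"
    and "w0 \<in> \<Omega>"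
    and "\<And>S t. S \<in> samples n P \<Longrightarrow>
           fst (nag \<eta> (nag_momentum \<kappa>) (empirical_risk l n S) w0 t) \<in> \<Omega> \<and>
           snd (nag \<eta> (nag_momentum \<kappa>) (empirical_risk l n S) w0 t) \<in> \<Omega>"
  shows "stability (\<lambda>S. fst (nag \<eta> (nag_momentum \<kappa>) (empirical_risk l n S) w0 T)) l P n
         \<le> ereal (4 * L\<^sup>2 / (\<alpha> * real n) * (1 - (1 - 1 / sqrt \<kappa>) ^ T))"
proof -
  define s where "s = sqrt \<kappa>"
  define \<epsilon> where "\<epsilon> = 4 * L\<^sup>2 / (\<alpha> * real n) * (1 - (1 - 1 / s) ^ T)"
  have n: "0 < real n" using \<open>n \<ge> 1\<close> by simp
  \<comment> \<open>A loss exists because a probability space is nonempty; its Lipschitz constant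
    gives \<open>0 \<le> L\<close>.\<close>
  obtain z0 where "z0 \<in> space P" using prob_space.not_empty[OF \<open>prob_space P\<close>] by blast
  then have L: "0 \<le> L" using assms(9) lipschitz_on_nonneg by blast
  define \<Theta> where "\<Theta> S t = fst (nag \<eta> (nag_momentum \<kappa>) (empirical_risk l n S) w0 t)" for S t
  define W where "W S t = snd (nag \<eta> (nag_momentum \<kappa>) (empirical_risk l n S) w0 t)" for S t
  have in\<Omega>: "\<Theta> S t \<in> \<Omega>" "W S t \<in> \<Omega>" if "S \<in> samples n P" for S t
    using assms(15)[OF that] by (auto simp: \<Theta>_def W_def)
  define good where "good z K b \<longleftrightarrow>
      (\<forall>x y. x \<bullet> (K *v y) = (K *v x) \<bullet> y) \<and>
      (\<forall>x. GDERIV (\<lambda>\<theta>. l \<theta> z) x :> K *v x + b) \<and>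
      (\<forall>x h. l (x + h) z = l x z + (K *v x + b) \<bullet> h + h \<bullet> (K *v h) / 2) \<and>
      (\<forall>v. \<alpha> * (v \<bullet> v) \<le> v \<bullet> (K *v v)) \<and> (\<forall>v. v \<bullet> (K *v v) \<le> \<beta> * (v \<bullet> v))" for z K b
  have "\<exists>K b. good z K b" if "z \<in> space P" for z
    using quadratic_gradient_hessian[OF assms(7)[OF that] assms(8)[OF that]]
    unfolding good_def by metis
  then obtain K b where good: "\<And>z. z \<in> space P \<Longrightarrow> good z (K z) (b z)"
    by metis
  have K_sym: "x \<bullet> (K z *v y) = (K z *v x) \<bullet> y"
    and K_gderiv: "GDERIV (\<lambda>\<theta>. l \<theta> z) x :> K z *v x + b z"
    and K_expand: "l (x + h) z = l x z + (K z *v x + b z) \<bullet> h + h \<bullet> (K z *v h) / 2"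
    and K_lower: "\<alpha> * (v \<bullet> v) \<le> v \<bullet> (K z *v v)"
    and K_upper: "v \<bullet> (K z *v v) \<le> \<beta> * (v \<bullet> v)"
    if "z \<in> space P" for z x y h v
    using good[OF that] unfolding good_def by blast+
  have gradient: "gradient (empirical_risk l n S) x = (1 / n) *\<^sub>R (\<Sum>j=1..n. K (S j) *v x + b (S j))"
    if "\<And>j. j \<in> {1..n} \<Longrightarrow> S j \<in> space P" for S x
  proof (rule gradient_eqI)
    have "((\<lambda>\<theta>. 1 / n * (\<Sum>j=1..n. l \<theta> (S j))) has_derivative
        (\<lambda>h. 1 / n * (\<Sum>j=1..n. h \<bullet> (K (S j) *v x + b (S j))))) (at x)"
      using K_gderiv[OF that] unfolding gderiv_def
      by (intro has_derivative_mult_right has_derivative_sum)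
    then show "GDERIV (empirical_risk l n S) x :>
        (1 / n) *\<^sub>R (\<Sum>j=1..n. K (S j) *v x + b (S j))"
      unfolding gderiv_def empirical_risk_def[abs_def] by (simp add: inner_sum_right)
  qed
  \<comment> \<open>The direction space of the affine hull of \<open>\<Omega>\<close>, which
    contains all differences of iterates.\<close>
  let ?V = "span ((\<lambda>x. - w0 + x) ` \<Omega>)"
  have diffV: "u - v \<in> ?V" if "u \<in> \<Omega>" "v \<in> \<Omega>" for u v
  proof -
    have "(- w0 + u) - (- w0 + v) \<in> ?V" using that by (intro span_diff span_base imageI)
    then show ?thesis by simp
  qed
  have grad_bound: "\<bar>(K z *v w + b z) \<bullet> v\<bar> \<le> L * norm v"
    if "z \<in> space P" "w \<in> \<Omega>" "v \<in> ?V" for z w v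
    using \<open>convex \<Omega>\<close> that(2) \<open>w0 \<in> \<Omega>\<close> assms(9)[OF that(1)] matrix_vector_mul_linear
      K_expand[OF that(1)] that(3)
    by (rule lipschitz_quadratic_gradient_bound)
  have "uniformly_stable (\<lambda>S. \<Theta> S T) l P n \<epsilon>"
    unfolding uniformly_stable_def
  proof (intro ballI impI SUP_least)
    fix k S S' z
    assume k: "k \<in> {1..n}" and S: "S \<in> samples n P" and S': "S' \<in> samples n P"
      and eq: "\<forall>j\<in>{1..n} - {k}. S j = S' j" and z: "z \<in> space P"
    have SP: "S j \<in> space P" "S' j \<in> space P" if "j \<in> {1..n}" for j
      using S S' that by (auto simp: samples_def space_PiM)
    \<comment> \<open>\<open>H\<close> is the Hessian of the risk on \<open>S\<close>. The input
      \<open>d t\<close> is the difference of the two risk gradients at the same point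
      \<open>W S' t\<close>, where only the summand \<open>k\<close> survives.\<close>
    define H where "H v = (1 / n) *\<^sub>R (\<Sum>j=1..n. K (S j) *v v)" for v
    define d where "d t = (1 / n) *\<^sub>R
      ((K (S k) *v W S' t + b (S k)) - (K (S' k) *v W S' t + b (S' k)))" for t
    have grad_diff: "gradient (empirical_risk l n S) (W S t)
        - gradient (empirical_risk l n S') (W S' t) = H (W S t - W S' t) + d t" for t
    proof -
      have "(\<Sum>j=1..n. (K (S j) *v W S' t + b (S j)) - (K (S' j) *v W S' t + b (S' j)))
          = (\<Sum>j=1..n. if j = k then real n *\<^sub>R d t else 0)"
        using eq n by (intro sum.cong) (auto simp: d_def)
      also have "\<dots> = real n *\<^sub>R d t" using k by simp
      finally have "(\<Sum>j=1..n. K (S j) *v W S t + b (S j)) - (\<Sum>j=1..n. K (S' j) *v W S' t + b (S' j))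
          = (\<Sum>j=1..n. K (S j) *v (W S t - W S' t)) + real n *\<^sub>R d t"
        by (simp add: sum.distrib sum_subtractf matrix_vector_mult_diff_distrib algebra_simps)
      then have "(1 / n) *\<^sub>R ((\<Sum>j=1..n. K (S j) *v W S t + b (S j))
            - (\<Sum>j=1..n. K (S' j) *v W S' t + b (S' j)))
          = (1 / n) *\<^sub>R ((\<Sum>j=1..n. K (S j) *v (W S t - W S' t)) + real n *\<^sub>R d t)"
        by (rule arg_cong)
      then show ?thesis
        using n gradient[OF SP(1)] gradient[OF SP(2)]
        by (simp add: H_def scaleR_right_diff_distrib scaleR_right_distrib)
    qed
    \<comment> \<open>The constant \<open>2 * L / n\<close> collects two loss gradients, each at
      most \<open>L\<close> along \<open>?V\<close>, with averaging weight
      \<open>1 / n\<close>.\<close>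
    have "norm (\<Theta> S T - \<Theta> S' T) \<le> (2 * L / n) / \<alpha> * (1 - (1 - 1 / sqrt (\<beta> / \<alpha>)) ^ T)"
    proof (rule nag_perturbation_bound[where V = ?V and H = H and d = d
          and x = "\<lambda>t. \<Theta> S t - \<Theta> S' t" and y = "\<lambda>t. W S t - W S' t"])
      show "linear H"
        unfolding H_def by (intro linear_compose_scale_right linear_compose_sum ballI
            matrix_vector_mul_linear)
      show "u \<bullet> H v = H u \<bullet> v" for u v
        unfolding H_def using K_sym[OF SP(1)]
        by (simp add: inner_sum_left inner_sum_right)
      show "\<alpha> * (v \<bullet> v) \<le> v \<bullet> H v" for v
        using sum_bounded_below[of "{1..n}" "\<alpha> * (v \<bullet> v)" "\<lambda>j. v \<bullet> (K (S j) *v v)"] K_lower[OF SP(1)] n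
        by (simp add: H_def inner_sum_right field_simps)
      show "v \<bullet> H v \<le> \<beta> * (v \<bullet> v)" for v
        using sum_bounded_above[of "{1..n}" "\<lambda>j. v \<bullet> (K (S j) *v v)" "\<beta> * (v \<bullet> v)"] K_upper[OF SP(1)] n
        by (simp add: H_def inner_sum_right field_simps)
      show "\<Theta> S (Suc t) - \<Theta> S' (Suc t) = W S t - W S' t - \<eta> *\<^sub>R (H (W S t - W S' t) + d t)" for t
        unfolding grad_diff[symmetric] by (simp add: \<Theta>_def W_def Let_def algebra_simps)
      show "W S (Suc t) - W S' (Suc t) =
          (1 + nag_momentum (\<beta> / \<alpha>)) *\<^sub>R (\<Theta> S (Suc t) - \<Theta> S' (Suc t))
          - nag_momentum (\<beta> / \<alpha>) *\<^sub>R (\<Theta> S t - \<Theta> S' t)" for t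
        by (simp add: \<Theta>_def W_def Let_def \<open>\<kappa> = \<beta> / \<alpha>\<close> algebra_simps)
      show "\<Theta> S t - \<Theta> S' t \<in> ?V" for t using in\<Omega> S S' diffV by blast
      show "\<bar>d t \<bullet> v\<bar> \<le> 2 * L / n * norm v" if "v \<in> ?V" for t v
      proof -
        have "\<bar>(K (S k) *v W S' t + b (S k)) \<bullet> v - (K (S' k) *v W S' t + b (S' k)) \<bullet> v\<bar>
            \<le> 2 * (L * norm v)"
          using grad_bound[OF SP(1)[OF k] in\<Omega>(2)[OF S'] that, of t]
            grad_bound[OF SP(2)[OF k] in\<Omega>(2)[OF S'] that, of t] by linarith
        then show ?thesis
          using n unfolding d_def by (simp add: inner_diff_left[symmetric] abs_mult divide_simps)
      qed
    qed (use assms L n in \<open>auto simp: \<Theta>_def W_def\<close>)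
    \<comment> \<open>The Lipschitz property of the test loss contributes the second factor
      \<open>L\<close>.\<close>
    then have "L * norm (\<Theta> S T - \<Theta> S' T) \<le> L * ((2 * L / n) / \<alpha> * (1 - (1 - 1 / s) ^ T))"
      unfolding s_def \<open>\<kappa> = \<beta> / \<alpha>\<close> using L by (rule mult_left_mono)
    also have "\<dots> = \<epsilon> / 2" using n \<open>0 < \<alpha>\<close> by (simp add: \<epsilon>_def power2_eq_square field_simps)
    also have "\<dots> \<le> \<epsilon>"
    proof -
      have "1 \<le> s" using assms by (simp add: s_def)
      then have "(1 - 1 / s) ^ T \<le> 1" by (intro power_le_one) auto
      then have "0 \<le> \<epsilon>" using \<open>0 < \<alpha>\<close> n by (simp add: \<epsilon>_def)
      then show ?thesis by simp
    qed
    finally show "ereal \<bar>l (\<Theta> S T) z - l (\<Theta> S' T) z\<bar> \<le> ereal \<epsilon>"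
      using lipschitz_onD[OF assms(9)[OF z] in\<Omega>(1)[OF S] in\<Omega>(1)[OF S'], of T T]
      by (simp add: dist_norm)
  qed
  then show ?thesis
    unfolding stability_def \<Theta>_def \<epsilon>_def s_def by (intro Inf_lower) blast
qed

end
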